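(* If there is a (tree-like) $\mathbf{ND}_{\text{Ł}_3}$ proof of a formula $D$ in $n$ steps, then there is an Ł$_{3_{n\vee}}$ proof of $\Rightarrow D$ in $O(n)$ steps.
   Context: Formulas are built from variables with $\wedge,\vee,\supset,\neg$. $\mathbf{ND}_{\text{Ł}_3}$ (Tamminga's natural deduction for 3-valued Łukasiewicz logic): derivations are trees; a single assumption $A$, or a single axiom $(A\vee\neg A)\vee((B\vee\neg B)\vee(A\supset B))$, is a derivation, and derivations are extended by the rules: EFQ: from $A$ and $\neg A$ infer $B$; $\wedge I$: from $A$, $B$ infer $A\wedge B$; $\wedge E$: from $A\wedge B$ infer $A$, resp. $B$; $\vee I$: from $A$ (resp. $B$) infer $A\vee B$; $\vee E$: from $A\vee B$, a derivation of $C$ from assumption $[A]$ and a derivation of $C$ from assumption $[B]$ infer $C$, discharging those assumptions; DN: $A$ and $\neg\neg A$ interderivable; DeM$_\vee$: $\neg(A\vee B)$ and $\neg A\wedge\neg B$ interderivable; DeM$_\wedge$: $\neg(A\wedge B)$ and $\neg A\vee\neg B$ interderivable; $\supset_1$: from $\neg A\wedge\neg B$ infer $A\supset B$; $\supset_2$: from $\neg A$ infer $(B\vee\neg B)\vee(A\supset B)$; $\supset_3$: from $\neg A\wedge B$ infer $A\supset B$; $\supset_4$: from $\neg B$ and $(A\supset B)\vee\neg(A\supset B)$ infer $A\vee\neg A$; $\supset_5$: from $B$ infer $(A\vee\neg A)\vee(A\supset B)$; $\supset_6$: from $A\wedge\neg B$ infer $\neg(A\supset B)$; $\supset_7$: from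 $A$ and $(A\supset B)\vee\neg(A\supset B)$ infer $B\vee\neg B$; $\supset_8$: from $A\wedge B$ infer $A\supset B$. A proof of $D$ is a tree with root $D$ and all assumptions discharged; steps = nodes. $\mathcal{H}\text{Łuk}$ axiom schemas: (1) $A\supset(B\supset A)$; (2) $(A\supset B)\supset((B\supset C)\supset(A\supset C))$; (3) $((A\supset B)\supset B)\supset((B\supset A)\supset A)$; (4) $((((A\supset B)\supset A)\supset A)\supset(B\supset C))\supset(B\supset C)$; (5) $(A\wedge B)\supset A$; (6) $(A\wedge B)\supset B$; (7) $(A\supset B)\supset((A\supset C)\supset(A\supset(B\wedge C)))$; (8) $A\supset(A\vee B)$; (9) $B\supset(A\vee B)$; (10) $(A\supset C)\supset((B\supset C)\supset((A\vee B)\supset C))$; (11) $(\neg B\supset\neg A)\supset(A\supset B)$. Ł$_{3_{n\vee}}$: a proof is a sequence of lines, each a formula with a context (finite sequence of open assumptions, initially empty); a line is available to a later one if its context is an initial subsequence of the later one's and it lies in no closed block; lines are: $\mathcal{H}\text{Łuk}$ axiom instances; opening an assumption $A$ (context $\Gamma*\langle A\rangle$, $\Gamma$ the context of the last available line); modus ponens from available lines; $\vee_{ne}$: from available $A\vee B$ in context $\Gamma$, a block opened by $A$ ending in $C$ and a block opened by $B$ ending in $C$, close both blocks (their lines become unavailable) and write $C$ in context $\Gamma$. A proof of $\Rightarrow D$ ends with $D$ in empty context; steps = lines. *)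

theory Defs
  imports Complex_Main "HOL-Library.Sublist" "HOL-Library.Landau_Symbols"
begin

datatype fm =
    Var nat
  | Neg fm  (\<open>\<^bold>\<not> _\<close> [90] 90)
  | Con fm fm  (infixr \<open>\<^bold>\<and>\<close> 80)
  | Dis fm fm  (infixr \<open>\<^bold>\<or>\<close> 75)
  | Imp fm fm  (infixr \<open>\<^bold>\<longrightarrow>\<close> 70)

text \<open>
  The rules of Tamminga's natural deduction for three-valued Lukasiewicz logic, except
  disjunction elimination, which discharges assumptions and is a constructor of the trees below.
\<close>

inductive nd_rule :: "fm list \<Rightarrow> fm \<Rightarrow> bool" where
  EFQ: "nd_rule [A, \<^bold>\<not> A] B"
| ConI: "nd_rule [A, B] (A \<^bold>\<and> B)"
| ConE1: "nd_rule [A \<^bold>\<and> B] A"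
| ConE2: "nd_rule [A \<^bold>\<and> B] B"
| DisI1: "nd_rule [A] (A \<^bold>\<or> B)"
| DisI2: "nd_rule [B] (A \<^bold>\<or> B)"
| DNI: "nd_rule [A] (\<^bold>\<not> \<^bold>\<not> A)"
| DNE: "nd_rule [\<^bold>\<not> \<^bold>\<not> A] A"
| DeMDis1: "nd_rule [\<^bold>\<not> (A \<^bold>\<or> B)] (\<^bold>\<not> A \<^bold>\<and> \<^bold>\<not> B)"
| DeMDis2: "nd_rule [\<^bold>\<not> A \<^bold>\<and> \<^bold>\<not> B] (\<^bold>\<not> (A \<^bold>\<or> B))"
| DeMCon1: "nd_rule [\<^bold>\<not> (A \<^bold>\<and> B)] (\<^bold>\<not> A \<^bold>\<or> \<^bold>\<not> B)"
| DeMCon2: "nd_rule [\<^bold>\<not> A \<^bold>\<or> \<^bold>\<not> B] (\<^bold>\<not> (A \<^bold>\<and> B))"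
| Imp1: "nd_rule [\<^bold>\<not> A \<^bold>\<and> \<^bold>\<not> B] (A \<^bold>\<longrightarrow> B)"
| Imp2: "nd_rule [\<^bold>\<not> A] ((B \<^bold>\<or> \<^bold>\<not> B) \<^bold>\<or> (A \<^bold>\<longrightarrow> B))"
| Imp3: "nd_rule [\<^bold>\<not> A \<^bold>\<and> B] (A \<^bold>\<longrightarrow> B)"
| Imp4: "nd_rule [\<^bold>\<not> B, (A \<^bold>\<longrightarrow> B) \<^bold>\<or> \<^bold>\<not> (A \<^bold>\<longrightarrow> B)] (A \<^bold>\<or> \<^bold>\<not> A)"
| Imp5: "nd_rule [B] ((A \<^bold>\<or> \<^bold>\<not> A) \<^bold>\<or> (A \<^bold>\<longrightarrow> B))"
| Imp6: "nd_rule [A \<^bold>\<and> \<^bold>\<not> B] (\<^bold>\<not> (A \<^bold>\<longrightarrow> B))"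
| Imp7: "nd_rule [A, (A \<^bold>\<longrightarrow> B) \<^bold>\<or> \<^bold>\<not> (A \<^bold>\<longrightarrow> B)] (B \<^bold>\<or> \<^bold>\<not> B)"
| Imp8: "nd_rule [A \<^bold>\<and> B] (A \<^bold>\<longrightarrow> B)"

text \<open>
  Assumptions carry a label. \<open>OrE S u A T v B U\<close> is an application of disjunction elimination
  to a derivation \<open>S\<close> of \<open>A \<^bold>\<or> B\<close>; it discharges the assumptions \<open>A\<close> labelled \<open>u\<close> in \<open>T\<close> and the
  assumptions \<open>B\<close> labelled \<open>v\<close> in \<open>U\<close>. The labels make it possible to discharge any chosen
  occurrences (possibly none) of the assumption.
\<close>

datatype nd_tree =
    Assm nat fm
  | Ax fm fm
  | Inf "nd_tree list" fm
  | OrE nd_tree nat fm nd_tree nat fm nd_tree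

fun nd_concl :: "nd_tree \<Rightarrow> fm" where
  "nd_concl (Assm u A) = A"
| "nd_concl (Ax A B) = ((A \<^bold>\<or> \<^bold>\<not> A) \<^bold>\<or> ((B \<^bold>\<or> \<^bold>\<not> B) \<^bold>\<or> (A \<^bold>\<longrightarrow> B)))"
| "nd_concl (Inf Ts C) = C"
| "nd_concl (OrE S u A T v B U) = nd_concl T"

fun nd_open :: "nd_tree \<Rightarrow> (nat \<times> fm) set" where
  "nd_open (Assm u A) = {(u, A)}"
| "nd_open (Ax A B) = {}"
| "nd_open (Inf Ts C) = (\<Union>T \<in> set Ts. nd_open T)"
| "nd_open (OrE S u A T v B U) =
     nd_open S \<union> (nd_open T - {(u, A)}) \<union> (nd_open U - {(v, B)})"

fun nd_derivation :: "nd_tree \<Rightarrow> bool" where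
  "nd_derivation (Assm u A) \<longleftrightarrow> True"
| "nd_derivation (Ax A B) \<longleftrightarrow> True"
| "nd_derivation (Inf Ts C) \<longleftrightarrow>
     (\<forall>T \<in> set Ts. nd_derivation T) \<and> nd_rule (map nd_concl Ts) C"
| "nd_derivation (OrE S u A T v B U) \<longleftrightarrow>
     nd_derivation S \<and> nd_derivation T \<and> nd_derivation U \<and>
     nd_concl S = (A \<^bold>\<or> B) \<and> nd_concl T = nd_concl U"

fun nd_steps :: "nd_tree \<Rightarrow> nat" where
  "nd_steps (Assm u A) = 1"
| "nd_steps (Ax A B) = 1"
| "nd_steps (Inf Ts C) = 1 + (\<Sum>T \<leftarrow> Ts. nd_steps T)"
| "nd_steps (OrE S u A T v B U) = 1 + nd_steps S + nd_steps T + nd_steps U"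

definition nd_proof :: "nd_tree \<Rightarrow> fm \<Rightarrow> bool" where
  "nd_proof T D \<longleftrightarrow> nd_derivation T \<and> nd_open T = {} \<and> nd_concl T = D"

inductive hluk_axiom :: "fm \<Rightarrow> bool" where
  H1: "hluk_axiom (A \<^bold>\<longrightarrow> (B \<^bold>\<longrightarrow> A))"
| H2: "hluk_axiom ((A \<^bold>\<longrightarrow> B) \<^bold>\<longrightarrow> ((B \<^bold>\<longrightarrow> C) \<^bold>\<longrightarrow> (A \<^bold>\<longrightarrow> C)))"
| H3: "hluk_axiom (((A \<^bold>\<longrightarrow> B) \<^bold>\<longrightarrow> B) \<^bold>\<longrightarrow> ((B \<^bold>\<longrightarrow> A) \<^bold>\<longrightarrow> A))"
| H4: "hluk_axiom (((((A \<^bold>\<longrightarrow> B) \<^bold>\<longrightarrow> A) \<^bold>\<longrightarrow> A) \<^bold>\<longrightarrow> (B \<^bold>\<longrightarrow> C)) \<^bold>\<longrightarrow> (B \<^bold>\<longrightarrow> C))"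
| H5: "hluk_axiom ((A \<^bold>\<and> B) \<^bold>\<longrightarrow> A)"
| H6: "hluk_axiom ((A \<^bold>\<and> B) \<^bold>\<longrightarrow> B)"
| H7: "hluk_axiom ((A \<^bold>\<longrightarrow> B) \<^bold>\<longrightarrow> ((A \<^bold>\<longrightarrow> C) \<^bold>\<longrightarrow> (A \<^bold>\<longrightarrow> (B \<^bold>\<and> C))))"
| H8: "hluk_axiom (A \<^bold>\<longrightarrow> (A \<^bold>\<or> B))"
| H9: "hluk_axiom (B \<^bold>\<longrightarrow> (A \<^bold>\<or> B))"
| H10: "hluk_axiom ((A \<^bold>\<longrightarrow> C) \<^bold>\<longrightarrow> ((B \<^bold>\<longrightarrow> C) \<^bold>\<longrightarrow> ((A \<^bold>\<or> B) \<^bold>\<longrightarrow> C)))"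
| H11: "hluk_axiom ((\<^bold>\<not> B \<^bold>\<longrightarrow> \<^bold>\<not> A) \<^bold>\<longrightarrow> (A \<^bold>\<longrightarrow> B))"

text \<open>
  Justifications refer to lines by position, counting from 0. \<open>MP j k\<close> has minor premise \<open>j\<close>
  and major premise \<open>k\<close>. \<open>OrNE d a b\<close> at line \<open>i\<close> uses the disjunction at line \<open>d\<close> and closes
  the block of lines \<open>a, ..., b - 1\<close> and the block of lines \<open>b, ..., i - 1\<close>.
\<close>

datatype justification = Axiom | Assumption | MP nat nat | OrNE nat nat nat

datatype line = Line (ctx: "fm list") (form: fm) (just: justification)

definition in_closed_block :: "line list \<Rightarrow> nat \<Rightarrow> nat \<Rightarrow> bool" where
  "in_closed_block p j i \<longleftrightarrow>
     (\<exists>m d a b. m < i \<and> just (p ! m) = OrNE d a b \<and> a \<le> j \<and> j < m)"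

definition available :: "line list \<Rightarrow> nat \<Rightarrow> nat \<Rightarrow> bool" where
  "available p j i \<longleftrightarrow>
     j < i \<and> prefix (ctx (p ! j)) (ctx (p ! i)) \<and> \<not> in_closed_block p j i"

text \<open>The lines \<open>s, ..., e - 1\<close> form a block opened by \<open>A\<close> in context \<open>\<Gamma>\<close> and ending in \<open>C\<close>.\<close>

definition block :: "line list \<Rightarrow> nat \<Rightarrow> nat \<Rightarrow> fm list \<Rightarrow> fm \<Rightarrow> fm \<Rightarrow> bool" where
  "block p s e \<Gamma> A C \<longleftrightarrow>
     s < e \<and> p ! s = Line (\<Gamma> @ [A]) A Assumption \<and>
     (\<forall>k \<in> {s..<e}. prefix (\<Gamma> @ [A]) (ctx (p ! k))) \<and>
     ctx (p ! (e - 1)) = \<Gamma> @ [A] \<and> form (p ! (e - 1)) = C"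

text \<open>
  The line just before \<open>i\<close> never lies in a block closed before \<open>i\<close>, so it is the last available
  one.
\<close>

definition current_ctx :: "line list \<Rightarrow> nat \<Rightarrow> fm list" where
  "current_ctx p i = (if i = 0 then [] else ctx (p ! (i - 1)))"

text \<open>
  An assumption is opened either inside the current context, or next to the innermost open
  block, as the second block of a disjunction elimination whose first block has just been
  finished (but is closed only together with the second one).
\<close>

fun correct_line :: "line list \<Rightarrow> nat \<Rightarrow> justification \<Rightarrow> bool" where
  "correct_line p i Axiom \<longleftrightarrow>
     hluk_axiom (form (p ! i)) \<and> ctx (p ! i) = current_ctx p i"
| "correct_line p i Assumption \<longleftrightarrow>
     (\<exists>\<Gamma>. ctx (p ! i) = \<Gamma> @ [form (p ! i)] \<and>
          (current_ctx p i = \<Gamma> \<or> (\<exists>A. current_ctx p i = \<Gamma> @ [A])))"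
| "correct_line p i (MP j k) \<longleftrightarrow>
     available p j i \<and> available p k i \<and>
     form (p ! k) = (form (p ! j) \<^bold>\<longrightarrow> form (p ! i)) \<and> ctx (p ! i) = current_ctx p i"
| "correct_line p i (OrNE d a b) \<longleftrightarrow>
     (\<exists>A B. available p d i \<and> form (p ! d) = (A \<^bold>\<or> B) \<and> ctx (p ! d) = ctx (p ! i) \<and>
            block p a b (ctx (p ! i)) A (form (p ! i)) \<and>
            block p b i (ctx (p ! i)) B (form (p ! i)))"

text \<open>
  The last condition says that every assumption has been closed. The empty context of the last
  line alone would not exclude a block that was left by opening another one next to it and
  never closed.
\<close>

definition l3nv_proof :: "line list \<Rightarrow> fm \<Rightarrow> bool" where
  "l3nv_proof p D \<longleftrightarrow>
     p \<noteq> [] \<and> (\<forall>i < length p. correct_line p i (just (p ! i))) \<and>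
     ctx (last p) = [] \<and> form (last p) = D \<and>
     (\<forall>i < length p. just (p ! i) = Assumption \<longrightarrow>
        (\<exists>m < length p. \<exists>d a b. just (p ! m) = OrNE d a b \<and> (i = a \<or> i = b)))"

end

theory Submission
  imports Defs
begin

text \<open>
  Every rule of the natural deduction system, and its axiom, is derivable from the Hilbert axioms
  and modus ponens; by closure under substitution, the number of lines this takes is the same for
  all instances of a rule, hence bounded by a constant. Disjunction elimination is simulated by
  the corresponding rule on blocks. As earlier lines can be reused, the conclusions of subtrees
  are never derived twice, and the total cost is linear.

  The only place where three-valuedness enters is the axiom
  \<open>(A \<^bold>\<or> \<^bold>\<not> A) \<^bold>\<or> ((B \<^bold>\<or> \<^bold>\<not> B) \<^bold>\<or> (A \<^bold>\<longrightarrow> B))\<close>. Since \<open>(P \<^bold>\<longrightarrow> Q) \<^bold>\<longrightarrow> Q\<close> implies \<open>P \<^bold>\<or> Q\<close>, axiom (4)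
  yields \<open>((A \<^bold>\<longrightarrow> B) \<^bold>\<or> A) \<^bold>\<or> (B \<^bold>\<longrightarrow> C)\<close>, and for refutable \<open>C\<close> the last disjunct gives \<open>\<^bold>\<not> B\<close>.
\<close>

section \<open>Derivations from available formulas\<close>

text \<open>
  \<open>derives n G A\<close>: if the formulas in \<open>G\<close> are available, at most \<open>n\<close> new lines suffice to
  reach a new line \<open>A\<close> in the same context. The cut rule expresses that a line, once derived, can
  be used any number of times.
\<close>

inductive derives :: "nat \<Rightarrow> fm set \<Rightarrow> fm \<Rightarrow> bool" where
  derives_axiom: "hluk_axiom A \<Longrightarrow> derives (Suc n) G A"
| derives_mp: "A \<in> G \<Longrightarrow> A \<^bold>\<longrightarrow> B \<in> G \<Longrightarrow> derives (Suc n) G B"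
| derives_cut: "derives m G A \<Longrightarrow> derives n (insert A G) C \<Longrightarrow> derives (m + n) G C"
| derives_disE: "derives k G (A \<^bold>\<or> B) \<Longrightarrow> derives m (insert A G) C \<Longrightarrow> derives n (insert B G) C
    \<Longrightarrow> derives (k + m + n + 3) G C"

text \<open>The leaf rules hold for every positive bound and so absorb any slack; the compound rules
  hand the slack to their last premise.\<close>

lemma derives_mono:
  assumes "derives n G A" "G \<subseteq> H" "n \<le> m"
  shows "derives m H A"
  using assms
proof (induction arbitrary: H m rule: derives.induct)
  case (derives_axiom A n G)
  then show ?case by (cases m) (auto intro: derives.intros)
next
  case (derives_mp A G B n)
  then show ?case by (cases m) (auto intro: derives.intros)
next
  case (derives_cut m G A n C H k)
  have "derives m H A" using derives_cut by blast
  moreover have "derives (k - m) (insert A H) C"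
    using derives_cut.prems by (intro derives_cut.IH(2)) auto
  ultimately have "derives (m + (k - m)) H C" by (rule derives.derives_cut)
  with derives_cut.prems show ?case by simp
next
  case (derives_disE k G A B m C n H l)
  have "derives k H (A \<^bold>\<or> B)" using derives_disE by blast
  moreover have "derives m (insert A H) C"
    using derives_disE.prems by (intro derives_disE.IH(2)) auto
  moreover have "derives (l - (k + m + 3)) (insert B H) C"
    using derives_disE.prems by (intro derives_disE.IH(3)) auto
  ultimately have "derives (k + m + (l - (k + m + 3)) + 3) H C" by (rule derives.derives_disE)
  with derives_disE.prems show ?case by (simp add: add.commute add.left_commute)
qed

text \<open>Serves inference nodes with a list of premises. The bound \<open>c\<close> varies in the
  induction because the head is cut into the continuation before the tail is treated.\<close>

lemma derives_cuts:
  assumes "\<forall>x \<in> set xs. derives (k x) G (f x)"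
    and "derives c (f ` set xs \<union> G) C"
  shows "derives ((\<Sum>x \<leftarrow> xs. k x) + c) G C"
  using assms
proof (induction xs arbitrary: c)
  case (Cons x xs)
  have "derives (k x) (f ` set xs \<union> G) (f x)"
    using Cons.prems(1) by (auto intro: derives_mono)
  moreover have "derives c (insert (f x) (f ` set xs \<union> G)) C"
    using Cons.prems(2) by simp
  ultimately have "derives (k x + c) (f ` set xs \<union> G) C"
    by (rule derives_cut)
  then have "derives ((\<Sum>x \<leftarrow> xs. k x) + (k x + c)) G C"
    using Cons by simp
  then show ?case by (simp add: ac_simps)
qed simp

section \<open>Closure under substitution\<close>

primrec subst :: "(nat \<Rightarrow> fm) \<Rightarrow> fm \<Rightarrow> fm" where
  "subst \<sigma> (Var i) = \<sigma> i"
| "subst \<sigma> (\<^bold>\<not> A) = \<^bold>\<not> subst \<sigma> A"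
| "subst \<sigma> (A \<^bold>\<and> B) = subst \<sigma> A \<^bold>\<and> subst \<sigma> B"
| "subst \<sigma> (A \<^bold>\<or> B) = subst \<sigma> A \<^bold>\<or> subst \<sigma> B"
| "subst \<sigma> (A \<^bold>\<longrightarrow> B) = subst \<sigma> A \<^bold>\<longrightarrow> subst \<sigma> B"

lemma hluk_axiom_subst: "hluk_axiom A \<Longrightarrow> hluk_axiom (subst \<sigma> A)"
  by (induction rule: hluk_axiom.induct) (auto intro: hluk_axiom.intros)

text \<open>Every rule is schematic in its formulas, so a derivation keeps its shape and its line
  count. All bounds that are uniform over rule instances come from here.\<close>

lemma derives_subst: "derives n G A \<Longrightarrow> derives n (subst \<sigma> ` G) (subst \<sigma> A)"
proof (induction rule: derives.induct)
  case (derives_axiom A n G)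
  then show ?case by (intro derives.derives_axiom hluk_axiom_subst)
next
  case (derives_mp A G B n)
  then have "subst \<sigma> A \<in> subst \<sigma> ` G" "subst \<sigma> A \<^bold>\<longrightarrow> subst \<sigma> B \<in> subst \<sigma> ` G"
    by (auto simp flip: subst.simps)
  then show ?case by (rule derives.derives_mp)
next
  case (derives_cut m G A n C)
  then show ?case by (auto intro: derives.derives_cut)
next
  case (derives_disE k G A B m C n)
  then show ?case by (auto intro: derives.derives_disE)
qed

section \<open>Derivable rules\<close>

definition derivable :: "fm set \<Rightarrow> fm \<Rightarrow> bool" (infix \<open>\<turnstile>\<close> 55) where
  "G \<turnstile> A \<longleftrightarrow> (\<exists>n. derives n G A)"

lemma derivable_axiom: "hluk_axiom A \<Longrightarrow> G \<turnstile> A"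
  unfolding derivable_def by (blast intro: derives_axiom)

lemma derivable_mono: "G \<turnstile> A \<Longrightarrow> G \<subseteq> H \<Longrightarrow> H \<turnstile> A"
  unfolding derivable_def by (blast intro: derives_mono)

lemma derivable_cut: "G \<turnstile> A \<Longrightarrow> insert A G \<turnstile> C \<Longrightarrow> G \<turnstile> C"
  unfolding derivable_def by (blast intro: derives_cut)

lemma derivable_disE: "G \<turnstile> A \<^bold>\<or> B \<Longrightarrow> insert A G \<turnstile> C \<Longrightarrow> insert B G \<turnstile> C \<Longrightarrow> G \<turnstile> C"
  unfolding derivable_def by (blast intro: derives_disE)

text \<open>\<open>derives_mp\<close> only sees members of the set, so both premises are first made
  members by cuts.\<close>

lemma derivable_mp:
  assumes "G \<turnstile> A \<^bold>\<longrightarrow> B" "G \<turnstile> A"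
  shows "G \<turnstile> B"
proof (rule derivable_cut[OF assms(1)], rule derivable_cut)
  show "insert (A \<^bold>\<longrightarrow> B) G \<turnstile> A" using assms(2) by (rule derivable_mono) blast
  show "insert A (insert (A \<^bold>\<longrightarrow> B) G) \<turnstile> B"
    unfolding derivable_def by (blast intro: derives_mp)
qed

lemmas derivable_axioms = hluk_axiom.intros[THEN derivable_axiom]

section \<open>Implication and negation\<close>

lemma derivable_weaken: "G \<turnstile> A \<Longrightarrow> G \<turnstile> B \<^bold>\<longrightarrow> A"
  by (rule derivable_mp[OF derivable_axioms(1)])

text \<open>The deduction theorem fails in three-valued Lukasiewicz logic, for want of contraction;
  implications are therefore composed explicitly.\<close>

lemma derivable_trans: "G \<turnstile> A \<^bold>\<longrightarrow> B \<Longrightarrow> G \<turnstile> B \<^bold>\<longrightarrow> C \<Longrightarrow> G \<turnstile> A \<^bold>\<longrightarrow> C"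
  by (rule derivable_mp[OF derivable_mp[OF derivable_axioms(2)]])

text \<open>\<open>H1\<close> gives \<open>A \<longrightarrow> ((B \<longrightarrow> A)
  \<longrightarrow> A)\<close>, and \<open>H3\<close> exchanges \<open>A\<close> and
  \<open>B\<close> in the nested implication.\<close>

lemma derivable_assertion: "G \<turnstile> A \<^bold>\<longrightarrow> ((A \<^bold>\<longrightarrow> B) \<^bold>\<longrightarrow> B)"
  by (rule derivable_trans[OF derivable_axioms(1) derivable_axioms(3)])

lemma derivable_discharge_theorem: "G \<turnstile> X \<Longrightarrow> G \<turnstile> (X \<^bold>\<longrightarrow> A) \<^bold>\<longrightarrow> A"
  by (rule derivable_mp[OF derivable_assertion])

lemma derivable_refl: "G \<turnstile> A \<^bold>\<longrightarrow> A"
  by (rule derivable_trans[OF derivable_axioms(1)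
        derivable_discharge_theorem[OF derivable_axioms(1)[of _ A A]]])

text \<open>There is no repetition rule; a member of \<open>G\<close> is repeated as a new line by
  modus ponens with \<open>A \<longrightarrow> A\<close>.\<close>

lemma derivable_member:
  assumes "A \<in> G"
  shows "G \<turnstile> A"
proof (rule derivable_cut[OF derivable_refl[of G A]])
  show "insert (A \<^bold>\<longrightarrow> A) G \<turnstile> A"
    unfolding derivable_def using assms by (blast intro: derives_mp)
qed

lemma derivable_efq: "G \<turnstile> \<^bold>\<not> A \<^bold>\<longrightarrow> (A \<^bold>\<longrightarrow> B)"
  by (rule derivable_trans[OF derivable_axioms(1) derivable_axioms(11)])

lemma derivable_dnE: "G \<turnstile> \<^bold>\<not> \<^bold>\<not> A \<^bold>\<longrightarrow> A"
proof -
  let ?X = "A \<^bold>\<longrightarrow> A"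
  \<comment> \<open>\<open>derivable_efq\<close> leads to
    \<open>\<not> A \<longrightarrow> \<not> ?X\<close>, which \<open>H11\<close> reverses to
    \<open>?X \<longrightarrow> A\<close>, an implication with provable antecedent.\<close>
  have "G \<turnstile> \<^bold>\<not> \<^bold>\<not> A \<^bold>\<longrightarrow> (?X \<^bold>\<longrightarrow> A)"
    by (rule derivable_trans[OF derivable_efq derivable_axioms(11)])
  then show ?thesis
    by (rule derivable_trans[OF _ derivable_discharge_theorem[OF derivable_refl]])
qed

lemma derivable_dnI: "G \<turnstile> A \<^bold>\<longrightarrow> \<^bold>\<not> \<^bold>\<not> A"
  by (rule derivable_mp[OF derivable_axioms(11) derivable_dnE])

lemma derivable_contrapos: "G \<turnstile> A \<^bold>\<longrightarrow> B \<Longrightarrow> G \<turnstile> \<^bold>\<not> B \<^bold>\<longrightarrow> \<^bold>\<not> A"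
  by (rule derivable_mp[OF derivable_axioms(11)
        derivable_trans[OF derivable_dnE derivable_trans[OF _ derivable_dnI]]])

lemma derivable_mt: "G \<turnstile> A \<^bold>\<longrightarrow> B \<Longrightarrow> G \<turnstile> \<^bold>\<not> B \<Longrightarrow> G \<turnstile> \<^bold>\<not> A"
  by (rule derivable_mp[OF derivable_contrapos])

section \<open>Conjunction and disjunction\<close>

lemma derivable_imp_conI: "G \<turnstile> A \<^bold>\<longrightarrow> B \<Longrightarrow> G \<turnstile> A \<^bold>\<longrightarrow> C \<Longrightarrow> G \<turnstile> A \<^bold>\<longrightarrow> (B \<^bold>\<and> C)"
  by (rule derivable_mp[OF derivable_mp[OF derivable_axioms(7)]])

lemma derivable_dis_impI: "G \<turnstile> A \<^bold>\<longrightarrow> C \<Longrightarrow> G \<turnstile> B \<^bold>\<longrightarrow> C \<Longrightarrow> G \<turnstile> (A \<^bold>\<or> B) \<^bold>\<longrightarrow> C"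
  by (rule derivable_mp[OF derivable_mp[OF derivable_axioms(10)]])

lemma derivable_conI: "G \<turnstile> A \<Longrightarrow> G \<turnstile> B \<Longrightarrow> G \<turnstile> A \<^bold>\<and> B"
  by (rule derivable_mp[OF derivable_imp_conI[OF derivable_refl derivable_weaken]])

lemma derivable_conE1: "G \<turnstile> A \<^bold>\<and> B \<Longrightarrow> G \<turnstile> A"
  by (rule derivable_mp[OF derivable_axioms(5)])

lemma derivable_conE2: "G \<turnstile> A \<^bold>\<and> B \<Longrightarrow> G \<turnstile> B"
  by (rule derivable_mp[OF derivable_axioms(6)])

lemma derivable_disI1: "G \<turnstile> A \<Longrightarrow> G \<turnstile> A \<^bold>\<or> B"
  by (rule derivable_mp[OF derivable_axioms(8)])

lemma derivable_disI2: "G \<turnstile> B \<Longrightarrow> G \<turnstile> A \<^bold>\<or> B"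
  by (rule derivable_mp[OF derivable_axioms(9)])

lemma derivable_not_imp: "G \<turnstile> \<^bold>\<not> A \<Longrightarrow> G \<turnstile> A \<^bold>\<longrightarrow> B"
  by (rule derivable_mp[OF derivable_efq])

text \<open>\<open>(A \<longrightarrow> B) \<longrightarrow> B\<close> is the Lukasiewicz definition
  of disjunction. \<open>H2\<close> and \<open>H8\<close> turn it into
  \<open>(?D \<longrightarrow> B) \<longrightarrow> B\<close>, \<open>H3\<close> swaps this to
  \<open>(B \<longrightarrow> ?D) \<longrightarrow> ?D\<close>, and \<open>H9\<close> supplies the
  antecedent.\<close>

lemma derivable_imp_imp_dis:
  assumes "G \<turnstile> (A \<^bold>\<longrightarrow> B) \<^bold>\<longrightarrow> B"
  shows "G \<turnstile> A \<^bold>\<or> B"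
proof -
  let ?D = "A \<^bold>\<or> B"
  have "G \<turnstile> (?D \<^bold>\<longrightarrow> B) \<^bold>\<longrightarrow> (A \<^bold>\<longrightarrow> B)"
    by (rule derivable_mp[OF derivable_axioms(2) derivable_axioms(8)])
  then have "G \<turnstile> (?D \<^bold>\<longrightarrow> B) \<^bold>\<longrightarrow> B"
    using assms by (rule derivable_trans)
  then have "G \<turnstile> (B \<^bold>\<longrightarrow> ?D) \<^bold>\<longrightarrow> ?D"
    by (rule derivable_mp[OF derivable_axioms(3)])
  then show ?thesis
    using derivable_axioms(9) by (rule derivable_mp)
qed

lemma derivable_nd_axiom: "G \<turnstile> (A \<^bold>\<or> \<^bold>\<not> A) \<^bold>\<or> ((B \<^bold>\<or> \<^bold>\<not> B) \<^bold>\<or> (A \<^bold>\<longrightarrow> B))"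
    (is "G \<turnstile> ?D")
proof -
  let ?X = "A \<^bold>\<longrightarrow> A"
  \<comment> \<open>With \<open>C\<close> taken as the refutable \<open>\<not> ?X\<close>,
    \<open>H4\<close> reads \<open>(?P \<longrightarrow> ?Q) \<longrightarrow> ?Q\<close>.\<close>
  let ?P = "((A \<^bold>\<longrightarrow> B) \<^bold>\<longrightarrow> A) \<^bold>\<longrightarrow> A" and ?Q = "B \<^bold>\<longrightarrow> \<^bold>\<not> ?X"
  have "G \<turnstile> ?P \<^bold>\<or> ?Q"
    by (rule derivable_imp_imp_dis[OF derivable_axioms(4)])
  then show ?thesis
  proof (rule derivable_disE)
    \<comment> \<open>\<open>?P\<close> is itself a defined disjunction, of
      \<open>A \<longrightarrow> B\<close> and \<open>A\<close>.\<close>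
    have "insert ?P G \<turnstile> (A \<^bold>\<longrightarrow> B) \<^bold>\<or> A"
      by (rule derivable_imp_imp_dis) (simp add: derivable_member)
    then show "insert ?P G \<turnstile> ?D"
      by (rule derivable_disE) (auto intro: derivable_disI1 derivable_disI2 derivable_member)
    have "insert ?Q G \<turnstile> \<^bold>\<not> \<^bold>\<not> ?X"
      by (rule derivable_mp[OF derivable_dnI derivable_refl])
    then have "insert ?Q G \<turnstile> \<^bold>\<not> B"
      by (rule derivable_mt[rotated]) (simp add: derivable_member)
    then show "insert ?Q G \<turnstile> ?D"
      by (auto intro: derivable_disI1 derivable_disI2)
  qed
qed

text \<open>Only \<open>Imp4\<close> and \<open>Imp7\<close> need a case split, on the excluded
  middle for \<open>A \<longrightarrow> B\<close> that they are given.\<close>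

lemma derivable_nd_rule:
  assumes "nd_rule Ps C"
  shows "set Ps \<turnstile> C"
  using assms
proof cases
  case (EFQ A)
  then show ?thesis
    by - (rule derivable_mp[OF derivable_not_imp, of _ A], simp_all add: derivable_member)
next
  case (ConI A B)
  then show ?thesis by (auto intro: derivable_conI derivable_member)
next
  case (ConE1 B)
  then show ?thesis by - (rule derivable_conE1[of _ _ B], simp_all add: derivable_member)
next
  case (ConE2 A)
  then show ?thesis by - (rule derivable_conE2[of _ A], simp_all add: derivable_member)
next
  case (DisI1 A B)
  then show ?thesis by (auto intro: derivable_disI1 derivable_member)
next
  case (DisI2 B A)
  then show ?thesis by (auto intro: derivable_disI2 derivable_member)
next
  case (DNI A)
  then show ?thesis by (simp add: derivable_mp[OF derivable_dnI] derivable_member)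
next
  case DNE
  then show ?thesis by - (rule derivable_mp[OF derivable_dnE], simp_all add: derivable_member)
next
  case (DeMDis1 A B)
  have "set Ps \<turnstile> \<^bold>\<not> (A \<^bold>\<or> B)"
    using DeMDis1 by (simp add: derivable_member)
  then have "set Ps \<turnstile> \<^bold>\<not> A \<^bold>\<and> \<^bold>\<not> B"
    using derivable_conI derivable_mt derivable_axioms(8,9) by metis
  with DeMDis1 show ?thesis by simp
next
  case (DeMDis2 A B)
  let ?G = "{\<^bold>\<not> A \<^bold>\<and> \<^bold>\<not> B}"
  \<comment> \<open>Each disjunct refutes the conjunction of the negations, so that conjunction
    refutes the disjunction by modus tollens.\<close>
  have "?G \<turnstile> (A \<^bold>\<or> B) \<^bold>\<longrightarrow> \<^bold>\<not> (\<^bold>\<not> A \<^bold>\<and> \<^bold>\<not> B)"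
    by (intro derivable_dis_impI;
        rule derivable_trans[OF derivable_dnI derivable_contrapos], rule derivable_axioms(5,6))
  then have "?G \<turnstile> \<^bold>\<not> (A \<^bold>\<or> B)"
    by (rule derivable_mt) (simp add: derivable_mp[OF derivable_dnI] derivable_member)
  with DeMDis2 show ?thesis by simp
next
  case (DeMCon1 A B)
  let ?G = "{\<^bold>\<not> (A \<^bold>\<and> B)}"
  \<comment> \<open>Contrapositive form: refuting \<open>\<not> A \<or> \<not> B\<close> refutes
    both disjuncts, whence \<open>A\<close> and \<open>B\<close>.\<close>
  have "?G \<turnstile> \<^bold>\<not> (\<^bold>\<not> A \<^bold>\<or> \<^bold>\<not> B) \<^bold>\<longrightarrow> (A \<^bold>\<and> B)"
    by (intro derivable_imp_conI;
        rule derivable_trans[OF derivable_contrapos derivable_dnE], rule derivable_axioms(8,9))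
  then have "?G \<turnstile> \<^bold>\<not> \<^bold>\<not> (\<^bold>\<not> A \<^bold>\<or> \<^bold>\<not> B)"
    by (rule derivable_mt) (simp add: derivable_member)
  then have "?G \<turnstile> \<^bold>\<not> A \<^bold>\<or> \<^bold>\<not> B"
    by (rule derivable_mp[OF derivable_dnE])
  with DeMCon1 show ?thesis by simp
next
  case (DeMCon2 A B)
  let ?G = "{\<^bold>\<not> A \<^bold>\<or> \<^bold>\<not> B}"
  have "?G \<turnstile> (\<^bold>\<not> A \<^bold>\<or> \<^bold>\<not> B) \<^bold>\<longrightarrow> \<^bold>\<not> (A \<^bold>\<and> B)"
    by (intro derivable_dis_impI derivable_contrapos derivable_axioms(5,6))
  then have "?G \<turnstile> \<^bold>\<not> (A \<^bold>\<and> B)"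
    by (rule derivable_mp) (simp add: derivable_member)
  with DeMCon2 show ?thesis by simp
next
  case (Imp1 A B)
  have "set Ps \<turnstile> A \<^bold>\<longrightarrow> B"
    by (rule derivable_not_imp, rule derivable_conE1[of _ _ "\<^bold>\<not> B"]) (simp add: Imp1 derivable_member)
  with Imp1 show ?thesis by simp
next
  case (Imp2 A B)
  then show ?thesis by (auto intro: derivable_disI2 derivable_not_imp derivable_member)
next
  case (Imp3 A B)
  have "set Ps \<turnstile> A \<^bold>\<longrightarrow> B"
    by (rule derivable_not_imp, rule derivable_conE1[of _ _ B]) (simp add: Imp3 derivable_member)
  with Imp3 show ?thesis by simp
next
  case (Imp4 B A)
  let ?I = "A \<^bold>\<longrightarrow> B"
  let ?G = "{\<^bold>\<not> B, ?I \<^bold>\<or> \<^bold>\<not> ?I}"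
  have "?G \<turnstile> ?I \<^bold>\<or> \<^bold>\<not> ?I" by (simp add: derivable_member)
  then have "?G \<turnstile> A \<^bold>\<or> \<^bold>\<not> A"
  proof (rule derivable_disE)
    show "insert ?I ?G \<turnstile> A \<^bold>\<or> \<^bold>\<not> A"
      by (rule derivable_disI2, rule derivable_mt[of _ _ B]) (simp_all add: derivable_member)
    \<comment> \<open>\<open>\<not> A\<close> would imply \<open>A \<longrightarrow> B\<close>,
      which is refuted in this case.\<close>
    have "insert (\<^bold>\<not> ?I) ?G \<turnstile> \<^bold>\<not> \<^bold>\<not> A"
      by (rule derivable_mt[OF derivable_efq[of _ A B]]) (simp add: derivable_member)
    then show "insert (\<^bold>\<not> ?I) ?G \<turnstile> A \<^bold>\<or> \<^bold>\<not> A"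
      by (rule derivable_disI1[OF derivable_mp[OF derivable_dnE]])
  qed
  with Imp4 show ?thesis by simp
next
  case (Imp5 B A)
  then show ?thesis by (auto intro: derivable_disI2 derivable_weaken derivable_member)
next
  case (Imp6 A B)
  let ?G = "{A \<^bold>\<and> \<^bold>\<not> B}"
  have G: "?G \<turnstile> A \<^bold>\<and> \<^bold>\<not> B" by (simp add: derivable_member)
  have "?G \<turnstile> (A \<^bold>\<longrightarrow> B) \<^bold>\<longrightarrow> B"
    by (rule derivable_discharge_theorem[OF derivable_conE1[OF G]])
  then have "?G \<turnstile> \<^bold>\<not> (A \<^bold>\<longrightarrow> B)"
    using derivable_conE2[OF G] by (rule derivable_mt)
  with Imp6 show ?thesis by simp
next
  case (Imp7 A B)
  let ?I = "A \<^bold>\<longrightarrow> B"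
  let ?G = "{A, ?I \<^bold>\<or> \<^bold>\<not> ?I}"
  have "?G \<turnstile> ?I \<^bold>\<or> \<^bold>\<not> ?I" by (simp add: derivable_member)
  then have "?G \<turnstile> B \<^bold>\<or> \<^bold>\<not> B"
  proof (rule derivable_disE)
    show "insert ?I ?G \<turnstile> B \<^bold>\<or> \<^bold>\<not> B"
      by (rule derivable_disI1, rule derivable_mp[of _ A]) (simp_all add: derivable_member)
    show "insert (\<^bold>\<not> ?I) ?G \<turnstile> B \<^bold>\<or> \<^bold>\<not> B"
      by (rule derivable_disI2, rule derivable_mt[OF derivable_axioms(1)[of _ B A]])
        (simp add: derivable_member)
  qed
  with Imp7 show ?thesis by simp
next
  case (Imp8 A B)
  have "set Ps \<turnstile> A \<^bold>\<longrightarrow> B"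
    by (rule derivable_weaken, rule derivable_conE2[of _ A]) (simp add: Imp8 derivable_member)
  with Imp8 show ?thesis by simp
qed

section \<open>Uniform bounds\<close>

text \<open>Finitely many schemes replace the infinitely many rule instances, so that their bounds
  can be collected. \<open>Var 0\<close> and \<open>Var 1\<close> stand for the two
  metavariables.\<close>

definition rule_schemes :: "(fm list \<times> fm) list" where
  "rule_schemes = (let A = Var 0; B = Var 1 in
    [([A, \<^bold>\<not> A], B),
     ([A, B], A \<^bold>\<and> B),
     ([A \<^bold>\<and> B], A),
     ([A \<^bold>\<and> B], B),
     ([A], A \<^bold>\<or> B),
     ([B], A \<^bold>\<or> B),
     ([A], \<^bold>\<not> \<^bold>\<not> A),
     ([\<^bold>\<not> \<^bold>\<not> A], A),
     ([\<^bold>\<not> (A \<^bold>\<or> B)], \<^bold>\<not> A \<^bold>\<and> \<^bold>\<not> B),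
     ([\<^bold>\<not> A \<^bold>\<and> \<^bold>\<not> B], \<^bold>\<not> (A \<^bold>\<or> B)),
     ([\<^bold>\<not> (A \<^bold>\<and> B)], \<^bold>\<not> A \<^bold>\<or> \<^bold>\<not> B),
     ([\<^bold>\<not> A \<^bold>\<or> \<^bold>\<not> B], \<^bold>\<not> (A \<^bold>\<and> B)),
     ([\<^bold>\<not> A \<^bold>\<and> \<^bold>\<not> B], A \<^bold>\<longrightarrow> B),
     ([\<^bold>\<not> A], (B \<^bold>\<or> \<^bold>\<not> B) \<^bold>\<or> (A \<^bold>\<longrightarrow> B)),
     ([\<^bold>\<not> A \<^bold>\<and> B], A \<^bold>\<longrightarrow> B),
     ([\<^bold>\<not> B, (A \<^bold>\<longrightarrow> B) \<^bold>\<or> \<^bold>\<not> (A \<^bold>\<longrightarrow> B)], A \<^bold>\<or> \<^bold>\<not> A),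
     ([B], (A \<^bold>\<or> \<^bold>\<not> A) \<^bold>\<or> (A \<^bold>\<longrightarrow> B)),
     ([A \<^bold>\<and> \<^bold>\<not> B], \<^bold>\<not> (A \<^bold>\<longrightarrow> B)),
     ([A, (A \<^bold>\<longrightarrow> B) \<^bold>\<or> \<^bold>\<not> (A \<^bold>\<longrightarrow> B)], B \<^bold>\<or> \<^bold>\<not> B),
     ([A \<^bold>\<and> B], A \<^bold>\<longrightarrow> B)])"

lemma rule_schemes_nd_rule: "(Qs, D) \<in> set rule_schemes \<Longrightarrow> nd_rule Qs D"
  unfolding rule_schemes_def Let_def by (auto intro: nd_rule.intros)

lemma nd_rule_instance_of_scheme:
  assumes "nd_rule Ps C"
  shows "\<exists>(Qs, D) \<in> set rule_schemes. \<exists>\<sigma>. Ps = map (subst \<sigma>) Qs \<and> C = subst \<sigma> D"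
proof -
  \<comment> \<open>The substitution is fixed up to its two values, so that it can be evaluated on
    each scheme.\<close>
  have "\<exists>A B. \<exists>(Qs, D) \<in> set rule_schemes.
      Ps = map (subst (\<lambda>i. if i = 0 then A else B)) Qs \<and>
      C = subst (\<lambda>i. if i = 0 then A else B) D"
    using assms unfolding rule_schemes_def Let_def by cases (simp_all, blast+)
  then show ?thesis by blast
qed

lemma derivable_uniform:
  assumes "set Qs \<turnstile> D"
  shows "\<exists>c. \<forall>\<sigma>. derives c (set (map (subst \<sigma>) Qs)) (subst \<sigma> D)"
proof -
  obtain c where "derives c (set Qs) D"
    using assms unfolding derivable_def by blast
  then show ?thesis
    using derives_subst by (intro exI[of _ c]) simp
qed

lemma nd_rule_derives_uniform: "\<exists>c. \<forall>Ps C. nd_rule Ps C \<longrightarrow> derives c (set Ps) C"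
proof -
  have "\<forall>r \<in> set rule_schemes.
      \<exists>c. \<forall>\<sigma>. derives c (set (map (subst \<sigma>) (fst r))) (subst \<sigma> (snd r))"
    by (auto intro!: derivable_uniform derivable_nd_rule rule_schemes_nd_rule simp del: set_map)
  then obtain c where c: "\<And>r \<sigma>. r \<in> set rule_schemes \<Longrightarrow>
      derives (c r) (set (map (subst \<sigma>) (fst r))) (subst \<sigma> (snd r))"
    by metis
  \<comment> \<open>The sum over the finite set of schemes dominates each single bound.\<close>
  have "derives (\<Sum>r \<in> set rule_schemes. c r) (set Ps) C" if rule: "nd_rule Ps C" for Ps C
  proof -
    obtain r \<sigma> where r: "r \<in> set rule_schemes" "Ps = map (subst \<sigma>) (fst r)" "C = subst \<sigma> (snd r)"
      using nd_rule_instance_of_scheme[OF rule] by fastforce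
    then have "derives (c r) (set Ps) C" using c by simp
    then show ?thesis by (rule derives_mono) (use r in \<open>auto intro: member_le_sum\<close>)
  qed
  then show ?thesis by blast
qed

lemma nd_axiom_derives_uniform: "\<exists>c. \<forall>A B. derives c {} (nd_concl (Ax A B))"
proof -
  obtain c where c: "\<And>\<sigma>. derives c {} (subst \<sigma> (nd_concl (Ax (Var 0) (Var 1))))"
    using derivable_uniform[of "[]"] derivable_nd_axiom by (simp del: subst.simps) blast
  have "derives c {} (nd_concl (Ax A B))" for A B
    using c[of "\<lambda>i. if i = 0 then A else B"] by simp
  then show ?thesis by blast
qed

text \<open>The cost of an assumption leaf, whose formula has to be repeated as a new line.\<close>

lemma member_derives_uniform: "\<exists>c. \<forall>A. derives c {A} A"
proof -
  obtain c where c: "\<And>\<sigma>. derives c {subst \<sigma> (Var 0)} (subst \<sigma> (Var 0))"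
    using derivable_uniform[of "[Var 0]" "Var 0"] derivable_member by auto
  have "derives c {A} A" for A
    using c[of "\<lambda>_. A"] by simp
  then show ?thesis by blast
qed

text \<open>Labels are forgotten: open assumptions count only as available formulas. Each node of
  the tree is charged at most \<open>K\<close> lines.\<close>

lemma nd_derivation_derives:
  "\<exists>K. \<forall>T. nd_derivation T \<longrightarrow> derives (K * nd_steps T) (snd ` nd_open T) (nd_concl T)"
proof -
  obtain c1 c2 c3 where
    c1: "\<And>Ps C. nd_rule Ps C \<Longrightarrow> derives c1 (set Ps) C" and
    c2: "\<And>A B. derives c2 {} (nd_concl (Ax A B))" and
    c3: "\<And>A. derives c3 {A} A"
    using nd_rule_derives_uniform nd_axiom_derives_uniform member_derives_uniform by metis
  \<comment> \<open>The summands pay for a rule, an axiom, an assumption and the three lines added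
    by \<open>derives_disE\<close>.\<close>
  define K where "K = c1 + c2 + c3 + 3"
  have "derives (K * nd_steps T) (snd ` nd_open T) (nd_concl T)" if "nd_derivation T" for T
    using that
  proof (induction T)
    case (Assm u A)
    show ?case using derives_mono[OF c3] by (simp add: K_def)
  next
    case (Ax A B)
    show ?case using derives_mono[OF c2, of _ K A B] by (simp add: K_def)
  next
    case (Inf Ts C)
    let ?G = "snd ` nd_open (Inf Ts C)"
    have "\<forall>T \<in> set Ts. derives (K * nd_steps T) ?G (nd_concl T)"
    proof
      fix T
      assume T: "T \<in> set Ts"
      then have "derives (K * nd_steps T) (snd ` nd_open T) (nd_concl T)"
        using Inf by simp
      then show "derives (K * nd_steps T) ?G (nd_concl T)"
        by (rule derives_mono) (use T in auto)
    qed
    moreover have "derives c1 (nd_concl ` set Ts \<union> ?G) C"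
      using Inf.prems by (intro derives_mono[OF c1[of "map nd_concl Ts"]]) auto
    ultimately have "derives ((\<Sum>T \<leftarrow> Ts. K * nd_steps T) + c1) ?G C"
      by (rule derives_cuts)
    then have "derives (K * nd_steps (Inf Ts C)) ?G C"
      by (rule derives_mono) (auto simp: sum_list_const_mult K_def)
    then show ?case by simp
  next
    case (OrE S u A T v B U)
    let ?G = "snd ` nd_open (OrE S u A T v B U)"
    have "derives (K * nd_steps S) ?G (A \<^bold>\<or> B)"
      using OrE.IH(1) OrE.prems by (auto intro: derives_mono)
    \<comment> \<open>An open assumption of \<open>T\<close> is the discharged \<open>(u, A)\<close>
      or stays open in the whole tree.\<close>
    moreover have "derives (K * nd_steps T) (insert A ?G) (nd_concl T)"
      by (rule derives_mono[OF OrE.IH(2)]) (use OrE.prems in force)+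
    moreover have "derives (K * nd_steps U) (insert B ?G) (nd_concl T)"
      using OrE.prems by (intro derives_mono[OF OrE.IH(3)[THEN back_subst[of "derives _ _"]]]) force+
    ultimately have "derives (K * nd_steps S + K * nd_steps T + K * nd_steps U + 3) ?G (nd_concl T)"
      by (rule derives_disE)
    then show ?case
      by (rule derives_mono[THEN back_subst[of "derives _ _"]]) (auto simp: K_def algebra_simps)
  qed
  then show ?thesis by blast
qed

section \<open>Writing derivations as sequences of lines\<close>

text \<open>Whatever the check of line \<open>i\<close> inspects lies at positions up to
  \<open>i\<close>.\<close>

lemma correct_line_append:
  assumes "i < length p"
  shows "correct_line (p @ q) i J \<longleftrightarrow> correct_line p i J"
proof -
  have nth: "(p @ q) ! j = p ! j" if "j \<le> i" for j
    using assms that by (simp add: nth_append)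
  have cur: "current_ctx (p @ q) i = current_ctx p i"
    by (simp add: current_ctx_def nth)
  have "in_closed_block (p @ q) j i \<longleftrightarrow> in_closed_block p j i" for j
    unfolding in_closed_block_def using nth by (metis less_imp_le)
  then have avail: "available (p @ q) j i \<longleftrightarrow> available p j i" for j
    unfolding available_def using nth by (metis less_imp_le order_refl)
  have block: "block (p @ q) s e \<Gamma> A C \<longleftrightarrow> block p s e \<Gamma> A C" if "e \<le> i" for s e \<Gamma> A C
    using that by (auto simp: block_def nth)
  have avail_less: "j < i" if "available p j i" for j
    using that by (simp add: available_def)
  have block_less: "s < e" if "block r s e \<Gamma> A C" for r s e \<Gamma> A C
    using that by (simp add: block_def)
  show ?thesis
  proof (cases J)
    case (MP j k)
    show ?thesis
      unfolding MP correct_line.simps avail cur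
      using nth avail_less by (metis less_imp_le order_refl)
  next
    case (OrNE d a b)
    \<comment> \<open>The blocks are treated together: the second one yields \<open>b < i\<close>,
      which the first one needs.\<close>
    have "block (p @ q) a b \<Gamma> A C \<and> block (p @ q) b i \<Gamma> B C \<longleftrightarrow>
        block p a b \<Gamma> A C \<and> block p b i \<Gamma> B C" for \<Gamma> A B C
      using block block_less by (metis less_imp_le order_refl)
    then show ?thesis
      unfolding OrNE correct_line.simps avail
      using nth avail_less by (metis less_imp_le order_refl)
  qed (simp_all add: cur nth)
qed

text \<open>Invariant of a piece of proof written from line \<open>s\<close> on. By the last clause
  it closes no block begun before \<open>s\<close>, which protects the earlier lines.\<close>

definition segment :: "line list \<Rightarrow> nat \<Rightarrow> fm list \<Rightarrow> bool" where
  "segment p s \<Gamma> \<longleftrightarrow> (\<forall>i \<in> {s..<length p}.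
     correct_line p i (just (p ! i)) \<and> prefix \<Gamma> (ctx (p ! i)) \<and>
     (\<forall>d a b. just (p ! i) = OrNE d a b \<longrightarrow> s \<le> a))"

text \<open>Kept apart from \<open>segment\<close>, since the assumption opening a block stays
  unclosed while the block is being written.\<close>

definition assumptions_closed :: "line list \<Rightarrow> nat \<Rightarrow> bool" where
  "assumptions_closed p s \<longleftrightarrow> (\<forall>i \<in> {s..<length p}. just (p ! i) = Assumption \<longrightarrow>
     (\<exists>m < length p. \<exists>d a b. just (p ! m) = OrNE d a b \<and> (i = a \<or> i = b)))"

text \<open>Availability as seen from a line not yet written, to be added at the end in context
  \<Gamma>.\<close>

definition usable :: "line list \<Rightarrow> fm list \<Rightarrow> fm \<Rightarrow> bool" where
  "usable p \<Gamma> A \<longleftrightarrow> (\<exists>j < length p.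
     form (p ! j) = A \<and> prefix (ctx (p ! j)) \<Gamma> \<and> \<not> in_closed_block p j (length p))"

lemma segment_append:
  assumes "segment p s \<Gamma>" "segment (p @ q) (length p) \<Delta>" "prefix \<Gamma> \<Delta>" "s \<le> length p"
  shows "segment (p @ q) s \<Gamma>"
  unfolding segment_def
proof (intro ballI)
  fix i
  assume i: "i \<in> {s..<length (p @ q)}"
  show "correct_line (p @ q) i (just ((p @ q) ! i)) \<and> prefix \<Gamma> (ctx ((p @ q) ! i)) \<and>
     (\<forall>d a b. just ((p @ q) ! i) = OrNE d a b \<longrightarrow> s \<le> a)"
  proof (cases "i < length p")
    case True
    then show ?thesis
      using assms(1) i by (auto simp: segment_def correct_line_append nth_append)
  next
    case False
    then have "i \<in> {length p..<length (p @ q)}"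
      using i by simp
    with assms(2) have "correct_line (p @ q) i (just ((p @ q) ! i))"
      "prefix \<Delta> (ctx ((p @ q) ! i))"
      "\<forall>d a b. just ((p @ q) ! i) = OrNE d a b \<longrightarrow> length p \<le> a"
      unfolding segment_def by blast+
    then show ?thesis
      using assms(3,4) prefix_order.trans order_trans by blast
  qed
qed

lemma assumptions_closed_append:
  assumes "assumptions_closed p s" "assumptions_closed (p @ q) (length p)"
  shows "assumptions_closed (p @ q) s"
  unfolding assumptions_closed_def
proof (intro ballI impI)
  fix i
  assume i: "i \<in> {s..<length (p @ q)}" "just ((p @ q) ! i) = Assumption"
  show "\<exists>m < length (p @ q). \<exists>d a b. just ((p @ q) ! m) = OrNE d a b \<and> (i = a \<or> i = b)"
  proof (cases "i < length p")
    case True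
    with i have "i \<in> {s..<length p}" "just (p ! i) = Assumption"
      by (auto simp: nth_append)
    then obtain m d a b where "m < length p" "just (p ! m) = OrNE d a b" "i = a \<or> i = b"
      using assms(1) unfolding assumptions_closed_def by blast
    then show ?thesis
      by (intro exI[of _ m]) (auto simp: nth_append)
  next
    case False
    then have "i \<in> {length p..<length (p @ q)}"
      using i by simp
    then show ?thesis
      using assms(2) i(2) unfolding assumptions_closed_def by blast
  qed
qed

text \<open>Blocks closed by the appended lines start at \<open>length p\<close> or later, hence
  contain no line of \<open>p\<close>.\<close>

lemma usable_append:
  assumes "usable p \<Gamma> A" "segment (p @ q) (length p) \<Delta>" "prefix \<Gamma> \<Gamma>'"
  shows "usable (p @ q) \<Gamma>' A"
proof -
  obtain j where j: "j < length p" "form (p ! j) = A" "prefix (ctx (p ! j)) \<Gamma>"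
      "\<not> in_closed_block p j (length p)"
    using assms(1) unfolding usable_def by blast
  have "\<not> in_closed_block (p @ q) j (length (p @ q))"
  proof
    assume "in_closed_block (p @ q) j (length (p @ q))"
    then obtain m d a b where m: "m < length (p @ q)" "just ((p @ q) ! m) = OrNE d a b"
        "a \<le> j" "j < m"
      unfolding in_closed_block_def by blast
    show False
    proof (cases "m < length p")
      case True
      then show False
        using m j(4) by (auto simp: in_closed_block_def nth_append)
    next
      case False
      then have "length p \<le> a"
        using m assms(2) unfolding segment_def by (metis atLeastLessThan_iff not_less)
      then show False
        using m j(1) by simp
    qed
  qed
  then show ?thesis
    unfolding usable_def using j prefix_order.trans[OF j(3) assms(3)]
    by (intro exI[of _ j]) (auto simp: nth_append)
qed

lemma usable_last:
  assumes "p \<noteq> []"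
  shows "usable p (ctx (last p)) (form (last p))"
  unfolding usable_def
  using assms by (intro exI[of _ "length p - 1"]) (auto simp: last_conv_nth in_closed_block_def)

section \<open>Opening and delimiting a block\<close>

lemma nth_append_last: "p \<noteq> [] \<Longrightarrow> (p @ q) ! (length p - 1) = last p"
  by (simp add: nth_append last_conv_nth)

lemma current_ctx_last: "p \<noteq> [] \<Longrightarrow> current_ctx p (length p) = ctx (last p)"
  by (simp add: current_ctx_def last_conv_nth)

lemma segment_snoc_iff:
  "segment (p @ [l]) (length p) \<Gamma> \<longleftrightarrow>
     correct_line (p @ [l]) (length p) (just l) \<and> prefix \<Gamma> (ctx l) \<and>
     (\<forall>d a b. just l = OrNE d a b \<longrightarrow> length p \<le> a)"
  by (auto simp: segment_def)

lemma current_ctx_snoc: "current_ctx (p @ [l]) (length p) = current_ctx p (length p)"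
  by (auto simp: current_ctx_def nth_append)

text \<open>The second alternative opens a block beside an unclosed one with assumption
  \<open>X\<close>, as the second half of a disjunction elimination.\<close>

lemma segment_assumption:
  assumes "current_ctx p (length p) = \<Gamma> \<or> (\<exists>X. current_ctx p (length p) = \<Gamma> @ [X])"
  shows "segment (p @ [Line (\<Gamma> @ [A]) A Assumption]) (length p) (\<Gamma> @ [A])"
  using assms by (simp add: segment_snoc_iff current_ctx_snoc)

lemma segment_imp_block:
  assumes p: "p = p' @ Line (\<Gamma> @ [A]) A Assumption # r"
    and seg: "segment p (length p') (\<Gamma> @ [A])"
    and last: "ctx (last p) = \<Gamma> @ [A]" "form (last p) = C"
  shows "block (p @ q) (length p') (length p) \<Gamma> A C"
proof -
  have "length p' < length p" "p \<noteq> []"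
    using p by simp_all
  moreover have "(p @ q) ! length p' = Line (\<Gamma> @ [A]) A Assumption"
    using p by simp
  moreover have "prefix (\<Gamma> @ [A]) (ctx ((p @ q) ! k))" if "k \<in> {length p'..<length p}" for k
    using seg that by (simp add: segment_def nth_append)
  ultimately show ?thesis
    unfolding block_def using nth_append_last[of p q] last by simp
qed

text \<open>\<open>p\<close> and \<Gamma> are generalised because a cut continues after lines
  already written and blocks are written in longer contexts.\<close>

lemma derives_imp_lines:
  assumes "derives n G C"
    and "current_ctx p (length p) = \<Gamma>"
    and "\<forall>A \<in> G. usable p \<Gamma> A"
  shows "\<exists>q. q \<noteq> [] \<and> length q \<le> n \<and> segment (p @ q) (length p) \<Gamma> \<and>
    assumptions_closed (p @ q) (length p) \<and> ctx (last q) = \<Gamma> \<and> form (last q) = C"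
  using assms
proof (induction arbitrary: p \<Gamma> rule: derives.induct)
  case (derives_axiom A n G)
  then show ?case
    by (intro exI[of _ "[Line \<Gamma> A Axiom]"])
      (auto simp: segment_snoc_iff current_ctx_snoc assumptions_closed_def)
next
  case (derives_mp A G B n)
  obtain j k where
    j: "j < length p" "form (p ! j) = A" "prefix (ctx (p ! j)) \<Gamma>"
      "\<not> in_closed_block p j (length p)" and
    k: "k < length p" "form (p ! k) = (A \<^bold>\<longrightarrow> B)" "prefix (ctx (p ! k)) \<Gamma>"
      "\<not> in_closed_block p k (length p)"
    using derives_mp unfolding usable_def by blast
  let ?p = "p @ [Line \<Gamma> B (MP j k)]"
  have "in_closed_block ?p i (length p) \<longleftrightarrow> in_closed_block p i (length p)" for i
    by (auto simp: in_closed_block_def nth_append)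
  then have "available ?p j (length p)" "available ?p k (length p)"
    using j k by (auto simp: available_def nth_append)
  then have "correct_line ?p (length p) (MP j k)"
    using j k derives_mp.prems by (simp add: current_ctx_snoc nth_append)
  then show ?case
    by (intro exI[of _ "[Line \<Gamma> B (MP j k)]"]) (auto simp: segment_snoc_iff assumptions_closed_def)
next
  case (derives_cut m G A n C)
  obtain q where q: "q \<noteq> []" "length q \<le> m" "segment (p @ q) (length p) \<Gamma>"
      "assumptions_closed (p @ q) (length p)" "ctx (last q) = \<Gamma>" "form (last q) = A"
    using derives_cut.IH(1) derives_cut.prems by blast
  \<comment> \<open>The cut formula is the last line written so far, and that line is in no closed
    block.\<close>
  have "\<forall>B \<in> insert A G. usable (p @ q) \<Gamma> B"
    using usable_last[of "p @ q"] q usable_append derives_cut.prems(2) by auto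
  moreover have "current_ctx (p @ q) (length (p @ q)) = \<Gamma>"
    using q by (subst current_ctx_last) auto
  ultimately obtain r where r: "r \<noteq> []" "length r \<le> n" "segment ((p @ q) @ r) (length (p @ q)) \<Gamma>"
      "assumptions_closed ((p @ q) @ r) (length (p @ q))" "ctx (last r) = \<Gamma>" "form (last r) = C"
    using derives_cut.IH(2) by blast
  show ?case
    using q r segment_append[OF q(3) r(3)] assumptions_closed_append[OF q(4) r(4)]
    by (intro exI[of _ "q @ r"]) auto
next
  case (derives_disE k G A B m C n)
  obtain q where q: "q \<noteq> []" "length q \<le> k" "segment (p @ q) (length p) \<Gamma>"
      "assumptions_closed (p @ q) (length p)" "ctx (last q) = \<Gamma>" "form (last q) = (A \<^bold>\<or> B)"
    using derives_disE.IH(1) derives_disE.prems by blast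
  define p1 where "p1 = p @ q"
  have p1: "p1 \<noteq> []" "last p1 = last q" "current_ctx p1 (length p1) = \<Gamma>"
    using q current_ctx_last[of p1] by (auto simp: p1_def)
  have G1: "usable p1 \<Gamma> X" if "X \<in> G" for X
    using usable_append[OF _ q(3)] derives_disE.prems(2) that unfolding p1_def by blast

  \<comment> \<open>One argument for both blocks. The opening line is left out of
    \<open>assumptions_closed\<close>, as only the line after both blocks closes it.\<close>
  have block: "\<exists>r. length r \<le> l \<and> segment (p' @ La # r) (length p') (\<Gamma> @ [D]) \<and>
      assumptions_closed (p' @ La # r) (Suc (length p')) \<and>
      ctx (last (La # r)) = \<Gamma> @ [D] \<and> form (last (La # r)) = C"
    if ih: "\<And>p \<Gamma>. current_ctx p (length p) = \<Gamma> \<Longrightarrow> \<forall>A \<in> insert D G. usable p \<Gamma> A \<Longrightarrow>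
        \<exists>q. q \<noteq> [] \<and> length q \<le> l \<and> segment (p @ q) (length p) \<Gamma> \<and>
          assumptions_closed (p @ q) (length p) \<and> ctx (last q) = \<Gamma> \<and> form (last q) = C"
      and cur: "current_ctx p' (length p') = \<Gamma> \<or> (\<exists>X. current_ctx p' (length p') = \<Gamma> @ [X])"
      and G': "\<forall>X \<in> G. usable p' \<Gamma> X"
      and La: "La = Line (\<Gamma> @ [D]) D Assumption"
    for D l p' La
  proof -
    have seg: "segment (p' @ [La]) (length p') (\<Gamma> @ [D])"
      unfolding La using cur by (rule segment_assumption)
    have "\<forall>X \<in> insert D G. usable (p' @ [La]) (\<Gamma> @ [D]) X"
      using usable_last[of "p' @ [La]"] usable_append[OF _ seg] G' by (auto simp: La)
    moreover have "current_ctx (p' @ [La]) (length (p' @ [La])) = \<Gamma> @ [D]"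
      by (subst current_ctx_last) (auto simp: La)
    ultimately obtain r where r: "r \<noteq> []" "length r \<le> l"
        "segment ((p' @ [La]) @ r) (length (p' @ [La])) (\<Gamma> @ [D])"
        "assumptions_closed ((p' @ [La]) @ r) (length (p' @ [La]))"
        "ctx (last r) = \<Gamma> @ [D]" "form (last r) = C"
      using ih by blast
    have "segment ((p' @ [La]) @ r) (length p') (\<Gamma> @ [D])"
      using segment_append[OF seg r(3)] by simp
    with r show ?thesis by (intro exI[of _ r]) auto
  qed

  define La where "La = Line (\<Gamma> @ [A]) A Assumption"
  obtain r where r: "length r \<le> m" "segment (p1 @ La # r) (length p1) (\<Gamma> @ [A])"
      "assumptions_closed (p1 @ La # r) (Suc (length p1))"
      "ctx (last (La # r)) = \<Gamma> @ [A]" "form (last (La # r)) = C"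
    using block[OF derives_disE.IH(2), where p' = p1 and La = La] p1 G1 La_def by blast
  define p2 where "p2 = p1 @ La # r"
  have p2: "p2 \<noteq> []" "last p2 = last (La # r)" "current_ctx p2 (length p2) = \<Gamma> @ [A]"
    using r current_ctx_last[of p2] by (auto simp: p2_def)
  \<comment> \<open>Usability is needed in \<Gamma>, not in the context of the first block, as the
    second block is opened beside it.\<close>
  have G2: "\<forall>X \<in> G. usable p2 \<Gamma> X"
    using usable_append[OF G1 r(2)] by (simp add: p2_def)
  define Lb where "Lb = Line (\<Gamma> @ [B]) B Assumption"
  obtain t where t: "length t \<le> n" "segment (p2 @ Lb # t) (length p2) (\<Gamma> @ [B])"
      "assumptions_closed (p2 @ Lb # t) (Suc (length p2))"
      "ctx (last (Lb # t)) = \<Gamma> @ [B]" "form (last (Lb # t)) = C"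
    using block[OF derives_disE.IH(3), where p' = p2 and La = Lb] p2 G2 Lb_def by blast
  define p3 where "p3 = p2 @ Lb # t"
  \<comment> \<open>The disjunction is the last line of \<open>p1\<close>; the blocks start right
    after \<open>p1\<close> and right after \<open>p2\<close>.\<close>
  define J where "J = OrNE (length p1 - 1) (length p1) (length p2)"
  define Lc where "Lc = Line \<Gamma> C J"

  have seg3: "segment p3 (length p1) \<Gamma>"
  proof -
    have "segment p2 (length p1) \<Gamma>"
      using r(2) unfolding segment_def p2_def by (meson append_prefixD)
    moreover have "segment p3 (length p2) \<Gamma>"
      using t(2) unfolding segment_def p3_def by (meson append_prefixD)
    ultimately show ?thesis
      using segment_append[of p2 "length p1" \<Gamma> "Lb # t" \<Gamma>] by (simp add: p3_def p2_def)
  qed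
  have len: "0 < length p1" "length p1 < length p2" "length p2 < length p3"
    using p1 by (auto simp: p2_def p3_def)
  have last1: "(p3 @ [Lc]) ! (length p1 - 1) = last q"
    using nth_append_last[OF p1(1), of "La # r @ Lb # t @ [Lc]"] p1(2) by (simp add: p3_def p2_def)
  \<comment> \<open>Every block closed between the disjunction and \<open>Lc\<close> starts after
    the disjunction.\<close>
  have "\<not> in_closed_block (p3 @ [Lc]) (length p1 - 1) (length p3)"
  proof
    assume "in_closed_block (p3 @ [Lc]) (length p1 - 1) (length p3)"
    then obtain i d a b where i: "i < length p3" "just ((p3 @ [Lc]) ! i) = OrNE d a b"
        "a \<le> length p1 - 1" "length p1 - 1 < i"
      unfolding in_closed_block_def by blast
    then have "i \<in> {length p1..<length p3}" "just (p3 ! i) = OrNE d a b"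
      by (auto simp: nth_append)
    then have "length p1 \<le> a"
      using seg3 unfolding segment_def by blast
    then show False
      using i(3) len(1) by linarith
  qed
  then have "available (p3 @ [Lc]) (length p1 - 1) (length p3)"
    using len last1 q by (auto simp: available_def Lc_def)
  moreover have "block (p3 @ [Lc]) (length p1) (length p2) \<Gamma> A C"
    using segment_imp_block[of p2 p1 \<Gamma> A r C "Lb # t @ [Lc]"] r p2(2)
    by (simp add: p3_def p2_def La_def)
  moreover have "block (p3 @ [Lc]) (length p2) (length p3) \<Gamma> B C"
    using segment_imp_block[of p3 p2 \<Gamma> B t C "[Lc]"] t
    by (simp add: p3_def Lb_def)
  ultimately have "correct_line (p3 @ [Lc]) (length p3) J"
    using last1 q by (auto simp: J_def Lc_def)
  then have "segment (p3 @ [Lc]) (length p1) \<Gamma>"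
    unfolding segment_def
  proof (intro ballI)
    fix i
    assume correct: "correct_line (p3 @ [Lc]) (length p3) J"
      and "i \<in> {length p1..<length (p3 @ [Lc])}"
    then consider "i \<in> {length p1..<length p3}" | "i = length p3"
      by fastforce
    then show "correct_line (p3 @ [Lc]) i (just ((p3 @ [Lc]) ! i)) \<and>
        prefix \<Gamma> (ctx ((p3 @ [Lc]) ! i)) \<and>
        (\<forall>d a b. just ((p3 @ [Lc]) ! i) = OrNE d a b \<longrightarrow> length p1 \<le> a)"
    proof cases
      case 1
      then show ?thesis
        using seg3 by (simp add: segment_def correct_line_append nth_append)
    next
      case 2
      then show ?thesis
        using correct by (simp add: Lc_def J_def)
    qed
  qed
  then have "segment (p @ q @ La # r @ Lb # t @ [Lc]) (length p) \<Gamma>"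
    using segment_append[OF q(3), of "La # r @ Lb # t @ [Lc]"]
    by (simp add: p3_def p2_def p1_def)
  moreover have "assumptions_closed (p @ q @ La # r @ Lb # t @ [Lc]) (length p)"
  proof -
    have c2: "\<exists>l < length (p3 @ [Lc]). \<exists>d a b. just ((p3 @ [Lc]) ! l) = OrNE d a b \<and> (i = a \<or> i = b)"
      if i: "i \<in> {Suc (length p1)..<length p2}" "just (p2 ! i) = Assumption" for i
    proof -
      obtain l d a b where "l < length p2" "just (p2 ! l) = OrNE d a b" "i = a \<or> i = b"
        using r(3) i unfolding assumptions_closed_def p2_def by blast
      then show ?thesis
        by (intro exI[of _ l]) (auto simp: p3_def nth_append)
    qed
    have c3: "\<exists>l < length (p3 @ [Lc]). \<exists>d a b. just ((p3 @ [Lc]) ! l) = OrNE d a b \<and> (i = a \<or> i = b)"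
      if i: "i \<in> {Suc (length p2)..<length p3}" "just (p3 ! i) = Assumption" for i
    proof -
      obtain l d a b where "l < length p3" "just (p3 ! l) = OrNE d a b" "i = a \<or> i = b"
        using t(3) i unfolding assumptions_closed_def p3_def by blast
      then show ?thesis
        by (intro exI[of _ l]) (auto simp: nth_append)
    qed
    have "assumptions_closed (p3 @ [Lc]) (length p1)"
      unfolding assumptions_closed_def
    proof (intro ballI impI)
      fix i
      assume i: "i \<in> {length p1..<length (p3 @ [Lc])}" "just ((p3 @ [Lc]) ! i) = Assumption"
      \<comment> \<open>\<open>Lc\<close> closes the two opening lines; deeper assumptions were
        closed within their block; \<open>Lc\<close> is no assumption.\<close>
      consider "i = length p1 \<or> i = length p2" | "i \<in> {Suc (length p1)..<length p2}"
        | "i \<in> {Suc (length p2)..<length p3}" | "i = length p3"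
        using i(1) by fastforce
      then show "\<exists>l < length (p3 @ [Lc]). \<exists>d a b.
          just ((p3 @ [Lc]) ! l) = OrNE d a b \<and> (i = a \<or> i = b)"
      proof cases
        case 1
        then show ?thesis
          by (intro exI[of _ "length p3"]) (auto simp: Lc_def J_def)
      next
        case 2
        then show ?thesis
          using i(2) by (intro c2) (auto simp: p3_def nth_append)
      next
        case 3
        then show ?thesis
          using i(2) by (intro c3) (auto simp: nth_append)
      next
        case 4
        then show ?thesis
          using i(2) by (simp add: Lc_def J_def)
      qed
    qed
    then show ?thesis
      using assumptions_closed_append[OF q(4), of "La # r @ Lb # t @ [Lc]"]
      by (simp add: p3_def p2_def p1_def)
  qed
  \<comment> \<open>\<open>La\<close>, \<open>Lb\<close> and \<open>Lc\<close> are the three extra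
    lines in the bound.\<close>
  ultimately show ?case
    using q(2) r(1) t(1)
    by (intro exI[of _ "q @ La # r @ Lb # t @ [Lc]"]) (auto simp: Lc_def)
qed

section \<open>The linear bound\<close>

lemma derives_imp_l3nv_proof:
  assumes "derives n {} D"
  shows "\<exists>p. l3nv_proof p D \<and> length p \<le> n"
proof -
  \<comment> \<open>Writing starts from no lines: the current context is then empty, and no formula
    has to be usable.\<close>
  obtain p where "p \<noteq> []" "length p \<le> n" "segment p 0 []" "assumptions_closed p 0"
      "ctx (last p) = []" "form (last p) = D"
    using derives_imp_lines[OF assms, of "[]" "[]"] by (auto simp: current_ctx_def)
  then show ?thesis
    unfolding l3nv_proof_def segment_def assumptions_closed_def
    by (intro exI[of _ p]) auto
qed

theorem theorem11:
  "\<exists>f :: nat \<Rightarrow> nat. (\<lambda>n. real (f n)) \<in> O(\<lambda>n. real n) \<and>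
     (\<forall>D n. (\<exists>T. nd_proof T D \<and> nd_steps T = n) \<longrightarrow>
            (\<exists>p. l3nv_proof p D \<and> length p \<le> f n))"
proof -
  obtain K where K: "\<And>T. nd_derivation T \<Longrightarrow>
      derives (K * nd_steps T) (snd ` nd_open T) (nd_concl T)"
    using nd_derivation_derives by blast
  \<comment> \<open>The witness for \<open>f\<close> is multiplication by the cost \<open>K\<close>
    per node.\<close>
  have "(\<lambda>n. real (K * n)) \<in> O(\<lambda>n. real n)"
    by (intro bigoI[of _ "real K"]) simp
  \<comment> \<open>A proof has no open assumptions, so the set of available formulas is
    empty.\<close>
  moreover have "\<exists>p. l3nv_proof p D \<and> length p \<le> K * nd_steps T" if "nd_proof T D" for T D
    using K[of T] that by (intro derives_imp_l3nv_proof) (auto simp: nd_proof_def)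
  ultimately show ?thesis
    by (intro exI[of _ "\<lambda>n. K * n"]) blast
qed

end
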